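(* Let $N\ge1$, $1<p<\infty$, $0<s<1$, let $\Omega\subset\mathbb{R}^N$ be a bounded open set with Lipschitz boundary, and let $u\in W^{s+\log,p}_0(\Omega)$. Put $\mathrm{diam}(\Omega):=\sup\{|x-y|:x,y\in\Omega\}$. Then the following assertions hold: (1) $$0\le\mathcal{J}_-(u,u)\le\frac{2^p\omega_N}{(sp)^2}\,C(N,s,p)\,\|u\|^p_{L^p(\Omega)}.$$ (2) If $\mathrm{diam}(\Omega)<1$, then $$\mathcal{J}_+(u,u)-\mathcal{J}_-(u,u)\ge-\frac{2\omega_N}{sp}\,C(N,s,p)\,(\mathrm{diam}(\Omega))^{-sp}\left(\ln(\mathrm{diam}(\Omega))+\frac1{sp}\right)\|u\|^p_{L^p(\Omega)}.$$ In particular, if $\mathrm{diam}(\Omega)\le e^{-\frac1{sp}}$, then $\mathcal{J}_+(u,u)-\mathcal{J}_-(u,u)\ge0$. (3) For every $0<r<1$, $$\mathcal{J}_s(u,u)\le-\frac{1}{C(N,s,p)\ln r}\,\|u\|^p_{W^{s+\log,p}_0(\Omega)}+\frac{2^p\omega_N}{sp}\,r^{-sp}\,\|u\|^p_{L^p(\Omega)}.$$ (4) Assume that $\mathrm{diam}(\Omega)\le e^{-\frac1{sp}}$ and $B(N,s,p)\ge0$. Then the functional $u\mapsto\mathcal{J}_{s+\log,p}(u,u)$ is nonnegative definite on $W^{s+\log,p}_0(\Omega)$, and $\mathcal{J}_{s+\log,p}(u,u)=0$ if and only if $u=0$. Moreover, $|u|\in W^{s+\log,p}_0(\Omega)$ and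 $$\mathcal{J}_{s+\log,p}(|u|,|u|)\le\mathcal{J}_{s+\log,p}(u,u),$$ with equality if and only if $u$ does not change sign.
   Context: Notation: $(a)_\pm=\max\{0,\pm a\}$; $\omega_N=\frac{2\pi^{N/2}}{\Gamma(N/2)}$ is the surface measure of the unit sphere of $\mathbb{R}^N$; $\psi=\Gamma'/\Gamma$; $$C(N,s,p)=\begin{cases}\dfrac{s\,p\,2^{2(s-1)}\,\Gamma\left(\frac{N+sp}{2}\right)}{\pi^{\frac{N-1}{2}}\,\Gamma(1-s)\,\Gamma\left(\frac{p+1}{2}\right)}, & s>\tfrac12,\\[8pt]\dfrac{s\,p\,2^{2s-1}\,\Gamma\left(\frac{N+sp}{2}\right)}{\pi^{\frac N2}\,\Gamma(1-s)}, & s\le\tfrac12,\end{cases}\qquad B(N,s,p)=2\ln2+\frac1s+\frac p2\psi\Big(\frac{N+sp}{2}\Big)+\psi(1-s).$$ Kernels: $\mathbf{k}^{s+\log,\pm}_p(z):=\dfrac{C(N,s,p)(-\ln|z|)_\pm}{|z|^{N+sp}}$ for $z\in\mathbb{R}^N\setminus\{0\}$. Function spaces: $W^{s+\log,p}(\mathbb{R}^N)$ is the space of $u\in L^p(\mathbb{R}^N)$ (real-valued) with $[u]^p_{s+\log,p}:=\iint_{\mathbb{R}^{2N}}|u(x)-u(y)|^p\mathbf{k}^{s+\log,+}_p(x-y)\,dx\,dy<\infty$; $W^{s+\log,p}_0(\Omega)$ is the subspace of those $u$ with $u=0$ a.e. in $\mathbb{R}^N\setminus\Omega$, with $\|u\|_{W^{s+\log,p}_0(\Omega)}:=[u]_{s+\log,p}$.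 Energy forms: $$\mathcal{J}_\pm(u,v)=\iint_{\mathbb{R}^{2N}}|u(x)-u(y)|^{p-2}(u(x)-u(y))(v(x)-v(y))\,\mathbf{k}^{s+\log,\pm}_p(x-y)\,dx\,dy,$$ $$\mathcal{J}_s(u,v)=\iint_{\mathbb{R}^{2N}}\frac{|u(x)-u(y)|^{p-2}(u(x)-u(y))(v(x)-v(y))}{|x-y|^{N+sp}}\,dx\,dy,$$ $$\mathcal{J}_{s+\log,p}(u,v)=\frac p2\big(\mathcal{J}_+(u,v)-\mathcal{J}_-(u,v)\big)+\frac{B(N,s,p)C(N,s,p)}{2}\mathcal{J}_s(u,v).$$ *)

theory Defs
  imports "HOL-Analysis.Analysis"
begin

definition sphere_area :: "nat \<Rightarrow> real" where
  "sphere_area N = 2 * pi powr (real N / 2) / Gamma (real N / 2)"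

definition C_const :: "nat \<Rightarrow> real \<Rightarrow> real \<Rightarrow> real" where
  "C_const N s p =
    (if s > 1 / 2
     then s * p * 2 powr (2 * (s - 1)) * Gamma ((real N + s * p) / 2) /
            (pi powr ((real N - 1) / 2) * Gamma (1 - s) * Gamma ((p + 1) / 2))
     else s * p * 2 powr (2 * s - 1) * Gamma ((real N + s * p) / 2) /
            (pi powr (real N / 2) * Gamma (1 - s)))"

definition B_const :: "nat \<Rightarrow> real \<Rightarrow> real \<Rightarrow> real" where
  "B_const N s p =
    2 * ln 2 + 1 / s + p / 2 * Digamma ((real N + s * p) / 2) + Digamma (1 - s)"

text \<open>
  The space \<open>\<real>\<^sup>N\<close> is a type of class \<^class>\<open>euclidean_space\<close> with \<open>N = DIM('a)\<close>. All kernels take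
  the value \<open>0\<close> at the origin (because \<open>0 powr a = 0\<close> and \<open>a / 0 = 0\<close>); this only concerns the
  diagonal of \<open>\<real>\<^sup>N \<times> \<real>\<^sup>N\<close>, which is a null set.
\<close>

definition log_kernel_pos :: "real \<Rightarrow> real \<Rightarrow> 'a::euclidean_space \<Rightarrow> real" where
  "log_kernel_pos s p z =
    C_const DIM('a) s p * max 0 (- ln (norm z)) / norm z powr (real DIM('a) + s * p)"

definition log_kernel_neg :: "real \<Rightarrow> real \<Rightarrow> 'a::euclidean_space \<Rightarrow> real" where
  "log_kernel_neg s p z =
    C_const DIM('a) s p * max 0 (- (- ln (norm z))) / norm z powr (real DIM('a) + s * p)"

definition frac_kernel :: "real \<Rightarrow> real \<Rightarrow> 'a::euclidean_space \<Rightarrow> real" where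
  "frac_kernel s p z = 1 / norm z powr (real DIM('a) + s * p)"

text \<open>
  Elements of the function spaces are functions rather than classes modulo equality almost
  everywhere. The measure on \<open>\<real>\<^sup>N \<times> \<real>\<^sup>N\<close> is the Lebesgue measure of the product type.
\<close>

definition Lp_norm :: "real \<Rightarrow> 'a::euclidean_space set \<Rightarrow> ('a \<Rightarrow> real) \<Rightarrow> real" where
  "Lp_norm p \<Omega> u = (LINT x:\<Omega>|lebesgue. \<bar>u x\<bar> powr p) powr (1 / p)"

definition slog_seminorm :: "real \<Rightarrow> real \<Rightarrow> ('a::euclidean_space \<Rightarrow> real) \<Rightarrow> real" where
  "slog_seminorm s p u =
    (\<integral>(x, y). \<bar>u x - u y\<bar> powr p * log_kernel_pos s p (x - y) \<partial>lebesgue) powr (1 / p)"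

definition W_slog :: "real \<Rightarrow> real \<Rightarrow> ('a::euclidean_space \<Rightarrow> real) set" where
  "W_slog s p =
    {u \<in> borel_measurable lebesgue.
       integrable lebesgue (\<lambda>x. \<bar>u x\<bar> powr p) \<and>
       integrable lebesgue (\<lambda>(x, y). \<bar>u x - u y\<bar> powr p * log_kernel_pos s p (x - y))}"

definition W_slog_0 :: "real \<Rightarrow> real \<Rightarrow> 'a::euclidean_space set \<Rightarrow> ('a \<Rightarrow> real) set" where
  "W_slog_0 s p \<Omega> = {u \<in> W_slog s p. AE x in lebesgue. x \<notin> \<Omega> \<longrightarrow> u x = 0}"

definition W_slog_0_norm :: "real \<Rightarrow> real \<Rightarrow> ('a::euclidean_space \<Rightarrow> real) \<Rightarrow> real" where
  "W_slog_0_norm s p u = slog_seminorm s p u"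

definition energy_density ::
  "real \<Rightarrow> ('a::euclidean_space \<Rightarrow> real) \<Rightarrow> ('a \<Rightarrow> real) \<Rightarrow> ('a \<Rightarrow> real) \<Rightarrow> 'a \<times> 'a \<Rightarrow> real" where
  "energy_density p k u v =
    (\<lambda>(x, y). \<bar>u x - u y\<bar> powr (p - 2) * (u x - u y) * (v x - v y) * k (x - y))"

text \<open>The Bochner integrals below are \<open>0\<close> by convention when the density is not integrable.\<close>

definition J_pos :: "real \<Rightarrow> real \<Rightarrow> ('a::euclidean_space \<Rightarrow> real) \<Rightarrow> ('a \<Rightarrow> real) \<Rightarrow> real" where
  "J_pos s p u v = (\<integral>z. energy_density p (log_kernel_pos s p) u v z \<partial>lebesgue)"

definition J_neg :: "real \<Rightarrow> real \<Rightarrow> ('a::euclidean_space \<Rightarrow> real) \<Rightarrow> ('a \<Rightarrow> real) \<Rightarrow> real" where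
  "J_neg s p u v = (\<integral>z. energy_density p (log_kernel_neg s p) u v z \<partial>lebesgue)"

definition J_frac :: "real \<Rightarrow> real \<Rightarrow> ('a::euclidean_space \<Rightarrow> real) \<Rightarrow> ('a \<Rightarrow> real) \<Rightarrow> real" where
  "J_frac s p u v = (\<integral>z. energy_density p (frac_kernel s p) u v z \<partial>lebesgue)"

definition J_slog :: "real \<Rightarrow> real \<Rightarrow> ('a::euclidean_space \<Rightarrow> real) \<Rightarrow> ('a \<Rightarrow> real) \<Rightarrow> real" where
  "J_slog s p u v =
    p / 2 * (J_pos s p u v - J_neg s p u v) +
    B_const DIM('a) s p * C_const DIM('a) s p / 2 * J_frac s p u v"

text \<open>
  Near each boundary point, in suitable orthonormal coordinates with last axis \<open>e\<close>, the set is the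
  strict epigraph of a Lipschitz function of the remaining \<open>N - 1\<close> coordinates, i.e. of a function
  on the hyperplane orthogonal to \<open>e\<close>.
\<close>

definition lipschitz_boundary :: "'a::euclidean_space set \<Rightarrow> bool" where
  "lipschitz_boundary \<Omega> \<longleftrightarrow>
    (\<forall>x0 \<in> frontier \<Omega>. \<exists>r > 0. \<exists>e \<gamma> L. norm e = 1 \<and>
       L-lipschitz_on {v. v \<bullet> e = 0} \<gamma> \<and>
       \<Omega> \<inter> ball x0 r = {y \<in> ball x0 r. \<gamma> (y - (y \<bullet> e) *\<^sub>R e) < y \<bullet> e})"

end

theory Submission
  imports Defs
begin

text \<open>
  Write \<open>a = s * p\<close>, \<open>N\<close> for the dimension, \<open>\<omega>\<close> for the area of the unit sphere, \<open>d\<close> for the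
  diameter of \<open>\<Omega>\<close>, and \<open>K z = C * (- ln (norm z)) / norm z powr (N + a)\<close>. This \<open>K\<close> is the
  difference of the two logarithmic kernels, so \<open>J_pos u u - J_neg u u\<close> is the integral of \<open>\<bar>u x -
  u y\<bar> powr p * K (x - y)\<close>. It changes sign only where \<open>norm z = 1\<close>.

  The upper bounds on \<open>J_neg\<close> and \<open>J_frac\<close> rest on cutting off the singularity of the kernel. Away
  from the origin the kernels are integrable, and \<open>\<bar>u x - u y\<bar> powr p \<le> 2 powr (p - 1) * (\<bar>u x\<bar>
  powr p + \<bar>u y\<bar> powr p)\<close> together with translation invariance bounds the energy by \<open>2 powr p\<close>
  times the \<open>p\<close>-th power of the \<open>L\<^sup>p\<close> norm times the integral of the kernel
  (\<open>energy_density_integrable_kernel\<close>). The kernel of \<open>J_neg\<close> already vanishes on the unit ball.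
  For \<open>J_frac\<close>, the part where \<open>0 < norm z \<le> r\<close> is absorbed by the positive logarithmic kernel,
  because \<open>1 \<le> ln (norm z) / ln r\<close> there (\<open>frac_kernel_le\<close>). All constants are values of the two
  radial integrals \<open>radial_tail_powr\<close> and \<open>radial_tail_ln\<close>, computed in polar coordinates.

  For the lower bound on \<open>J_pos - J_neg\<close>, sort the pairs \<open>(x, y)\<close> by membership in \<open>\<Omega>\<close>. Two points
  outside \<open>\<Omega>\<close> contribute nothing. Two points of \<open>\<Omega>\<close> have distance at most \<open>d < 1\<close>, where \<open>K \<ge> 0\<close>.
  For \<open>x \<in> \<Omega>\<close> and \<open>y \<notin> \<Omega>\<close> the density is \<open>\<bar>u x\<bar> powr p * K (x - y)\<close>. It is nonnegative when \<open>dist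
  x y \<le> d\<close>, whereas every \<open>y\<close> with \<open>dist x y > d\<close> lies outside \<open>\<Omega>\<close>, so that this far part can be
  integrated exactly. The same holds with \<open>x\<close> and \<open>y\<close> exchanged. The two far parts together are
  the lower bound, and they are nonnegative if \<open>d \<le> exp (- 1 / a)\<close>.

  If \<open>J_slog u u = 0\<close>, then \<open>J_pos u u - J_neg u u \<le> 0\<close>, because the fractional term is
  nonnegative. Definiteness now follows from what the lower bound discards
  (\<open>log_energy_near_far\<close>): the discarded part has integral zero, so for almost every \<open>x\<close> with \<open>u x
  \<noteq> 0\<close> the ball of radius \<open>d\<close> about \<open>x\<close> is contained in \<open>\<Omega>\<close> up to a null set. That is impossible,
  since the ball has diameter \<open>2 * d\<close> (\<open>not_AE_ball_diameter_subset\<close>). For the comparison with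
  \<open>\<bar>u\<bar>\<close>, the reverse triangle inequality applies where both points lie in \<open>\<Omega>\<close>, and elsewhere the
  densities agree. Equality forces \<open>u x * u y \<ge> 0\<close> for almost every pair, which excludes a change
  of sign.

  The argument is carried out for Borel functions that vanish everywhere outside \<open>\<Omega>\<close> (the locale
  \<open>slog_function\<close>), because then Fubini's theorem applies to Borel measure on the product. Each
  element of the function space agrees almost everywhere with such a function, and every quantity
  in the theorem depends only on the class modulo equality almost everywhere.
\<close>

section \<open>Radial integrals\<close>

lemma sphere_area_unit_ball_vol:
  assumes "0 < n"
  shows "sphere_area n = real n * unit_ball_vol (real n)"
proof -
  have "Gamma (real n / 2 + 1) = real n / 2 * Gamma (real n / 2)"
    by (rule Gamma_plus1) (use assms in \<open>auto elim!: nonpos_Ints_cases\<close>)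
  then have "unit_ball_vol (real n) = pi powr (real n / 2) / (real n / 2 * Gamma (real n / 2))"
    by (simp only: unit_ball_vol_def)
  then show ?thesis
    using assms by (simp add: sphere_area_def)
qed

lemma sphere_area_pos: "0 < n \<Longrightarrow> 0 < sphere_area n"
  by (simp add: sphere_area_unit_ball_vol)

text \<open>
  Polar coordinates for radial integrands: the volume \<open>\<omega> / N * c ^ N\<close> of the ball of radius \<open>c\<close>
  determines the image of Lebesgue measure under the norm.
\<close>

lemma distr_norm_lborel:
  "distr (lborel :: 'a::euclidean_space measure) borel norm =
     density lborel (\<lambda>t. ennreal (sphere_area DIM('a) * t ^ (DIM('a) - 1)) * indicator {0..} t)"
  (is "?M = ?N")
proof (rule measure_eqI_generator_eq[where \<Omega> = UNIV and E = "range atMost" and A = "\<lambda>n. {..real n}"])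
  show "Int_stable (range (atMost :: real \<Rightarrow> real set))"
    by (auto simp: Int_stable_def)
  show "sets ?M = sigma_sets UNIV (range atMost)" "sets ?N = sigma_sets UNIV (range atMost)"
    by (auto simp: borel_eq_atMost full_SetCompr_eq)
  show "(\<Union>n. {..real n}) = UNIV"
    by (auto intro: real_arch_simple)
  have M: "emeasure ?M {..c} = (if 0 \<le> c then ennreal (unit_ball_vol DIM('a) * c ^ DIM('a)) else 0)"
    for c
  proof -
    have "emeasure ?M {..c} = emeasure lborel (cball (0 :: 'a) c)"
      by (subst emeasure_distr) (auto simp: cball_def intro!: arg_cong[where f = "emeasure lborel"])
    then show ?thesis
      by (auto simp: emeasure_cball)
  qed
  have N: "emeasure ?N {..c} = (if 0 \<le> c then ennreal (unit_ball_vol DIM('a) * c ^ DIM('a)) else 0)"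
    for c
  proof -
    have nn: "0 \<le> sphere_area DIM('a) * t ^ (DIM('a) - 1)" if "0 \<le> t" for t
      using that sphere_area_pos[of "DIM('a)"] by simp
    have "emeasure ?N {..c} =
        (\<integral>\<^sup>+t. ennreal (sphere_area DIM('a) * t ^ (DIM('a) - 1)) * indicator {0..c} t \<partial>lborel)"
      by (subst emeasure_density) (auto intro!: nn_integral_cong split: split_indicator)
    also have "\<dots> = (if 0 \<le> c then ennreal (unit_ball_vol DIM('a) * c ^ DIM('a)) else 0)"
    proof (cases "0 \<le> c")
      case True
      have "(\<integral>\<^sup>+t. ennreal (sphere_area DIM('a) * t ^ (DIM('a) - 1)) * indicator {0..c} t \<partial>lborel)
          = unit_ball_vol DIM('a) * c ^ DIM('a) - unit_ball_vol DIM('a) * 0 ^ DIM('a)"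
      proof (rule nn_integral_FTC_Icc)
        fix t :: real assume "t \<in> {0..c}"
        then show "((\<lambda>t. unit_ball_vol DIM('a) * t ^ DIM('a)) has_real_derivative
            sphere_area DIM('a) * t ^ (DIM('a) - 1)) (at t)" "0 \<le> sphere_area DIM('a) * t ^ (DIM('a) - 1)"
          using nn by (auto intro!: derivative_eq_intros simp: sphere_area_unit_ball_vol)
      qed (use True in auto)
      then show ?thesis
        using True by simp
    qed simp
    finally show ?thesis .
  qed
  show "emeasure ?M X = emeasure ?N X" if "X \<in> range atMost" for X
    using that by (auto simp only: M N)
  show "emeasure ?M {..real n} \<noteq> \<infinity>" for n
    by (simp only: M) auto
qed auto

lemma nn_integral_radial:
  assumes [measurable]: "f \<in> borel_measurable borel"
  shows "(\<integral>\<^sup>+z. f (norm (z :: 'a::euclidean_space)) \<partial>lborel) =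
    (\<integral>\<^sup>+t. f t * ennreal (sphere_area DIM('a) * t ^ (DIM('a) - 1)) * indicator {0..} t \<partial>lborel)"
proof -
  have "(\<integral>\<^sup>+z. f (norm (z :: 'a)) \<partial>lborel) = (\<integral>\<^sup>+t. f t \<partial>distr (lborel :: 'a measure) borel norm)"
    by (simp add: nn_integral_distr)
  also have "\<dots> =
      (\<integral>\<^sup>+t. f t * ennreal (sphere_area DIM('a) * t ^ (DIM('a) - 1)) * indicator {0..} t \<partial>lborel)"
    unfolding distr_norm_lborel by (subst nn_integral_density) (auto simp: mult_ac)
  finally show ?thesis .
qed

text \<open>
  After passing to polar coordinates, the integral over the complement of a ball is the increment
  of an antiderivative \<open>F\<close> of \<open>g t * t ^ (N - 1)\<close>, normalised to vanish at infinity.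
\<close>

lemma has_bochner_integral_radial_tail:
  fixes g F :: "real \<Rightarrow> real"
  assumes [measurable]: "g \<in> borel_measurable borel" and "0 < r"
    and deriv: "\<And>t. r \<le> t \<Longrightarrow> (F has_real_derivative g t * t ^ (DIM('a) - 1)) (at t)"
    and nonneg: "\<And>t. r \<le> t \<Longrightarrow> 0 \<le> g t"
    and lim: "(F \<longlongrightarrow> 0) at_top"
  shows "has_bochner_integral lborel
    (\<lambda>z::'a::euclidean_space. indicator {z. r < norm z} z * g (norm z)) (sphere_area DIM('a) * - F r)"
proof (rule has_bochner_integral_nn_integral)
  let ?w = "sphere_area DIM('a)"
  have w: "0 < ?w"
    by (simp add: sphere_area_pos)
  have "(\<integral>\<^sup>+z. ennreal (indicator {z. r < norm z} z * g (norm (z::'a))) \<partial>lborel) =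
      (\<integral>\<^sup>+z. ennreal (indicator {r<..} (norm z) * g (norm (z::'a))) \<partial>lborel)"
    by (auto intro!: nn_integral_cong split: split_indicator)
  also have "\<dots> = (\<integral>\<^sup>+t. ennreal (indicator {r<..} t * g t) * ennreal (?w * t ^ (DIM('a) - 1)) *
      indicator {0..} t \<partial>lborel)"
    by (rule nn_integral_radial[where f = "\<lambda>t. ennreal (indicator {r<..} t * g t)"]) simp
  also have "\<dots> = (\<integral>\<^sup>+t. ennreal (?w * (g t * t ^ (DIM('a) - 1))) * indicator {r..} t \<partial>lborel)"
    using AE_lborel_singleton[of r] assms(2) nonneg w
    by (intro nn_integral_cong_AE)
      (auto elim!: eventually_mono split: split_indicator simp: ennreal_mult' [symmetric] mult_ac)
  also have "\<dots> = ennreal (?w * 0 - ?w * F r)"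
    using assms(2) w
    by (intro nn_integral_FTC_atLeast DERIV_cmult tendsto_mult_left lim deriv)
      (auto intro!: mult_nonneg_nonneg nonneg)
  finally show "(\<integral>\<^sup>+z. ennreal (indicator {z. r < norm z} z * g (norm (z::'a))) \<partial>lborel) =
      ennreal (?w * - F r)"
    by simp
  \<comment> \<open>\<open>F\<close> increases to its limit \<open>0\<close>, hence \<open>F r \<le> 0\<close>.\<close>
  have "F r \<le> F t" if "r \<le> t" for t
    using that assms(2)
    by (intro DERIV_nonneg_imp_nondecreasing[OF that])
       (meson deriv le_cases mult_nonneg_nonneg nonneg order_trans zero_le_power less_imp_le)
  then have "F r \<le> 0"
    by (intro tendsto_lowerbound[OF lim]) (auto simp: eventually_at_top_linorder)
  then show "0 \<le> ?w * - F r"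
    using w by (simp add: mult_nonneg_nonpos)
qed (use nonneg in \<open>auto split: split_indicator\<close>)

lemma radial_tail_powr:
  assumes "0 < r" "0 < a"
  shows "has_bochner_integral lborel
    (\<lambda>z::'a::euclidean_space. indicator {z. r < norm z} z * (1 / norm z powr (real DIM('a) + a)))
    (sphere_area DIM('a) * (r powr - a / a))"
proof -
  have "has_bochner_integral lborel
    (\<lambda>z::'a::euclidean_space. indicator {z. r < norm z} z * (1 / norm z powr (real DIM('a) + a)))
    (sphere_area DIM('a) * - (- (r powr - a) / a))"
  proof (rule has_bochner_integral_radial_tail[OF _ assms(1)])
    fix t assume "r \<le> t"
    then have t: "0 < t" using assms by simp
    have e: "1 / t powr (real DIM('a) + a) * t ^ (DIM('a) - 1) = t powr (- a - 1)"
      using t by (simp add: powr_realpow [symmetric] powr_diff powr_add powr_minus field_simps of_nat_diff)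
    show "((\<lambda>t. - (t powr - a) / a) has_real_derivative
        1 / t powr (real DIM('a) + a) * t ^ (DIM('a) - 1)) (at t)"
      unfolding e using t assms by (auto intro!: derivative_eq_intros)
  next
    have "((\<lambda>t. t powr - a) \<longlongrightarrow> 0) at_top"
      using assms by (intro tendsto_neg_powr filterlim_ident) auto
    then have "((\<lambda>t. - (t powr - a) / a) \<longlongrightarrow> - 0 / a) at_top"
      using assms by (intro tendsto_intros) auto
    then show "((\<lambda>t. - (t powr - a) / a) \<longlongrightarrow> 0) at_top" by simp
  qed auto
  then show ?thesis by simp
qed

lemma radial_tail_ln:
  assumes "0 < r" "0 < a"
  shows "has_bochner_integral lborel
    (\<lambda>z::'a::euclidean_space. indicator {z. r < norm z} z * (ln (norm z) / norm z powr (real DIM('a) + a)))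
    (sphere_area DIM('a) * r powr - a * (ln r / a + 1 / a\<^sup>2))"
proof -
  \<comment> \<open>Writing \<open>ln t = ln (t / r) + ln r\<close> makes the first integrand nonnegative for \<open>t \<ge> r\<close>, also
    when \<open>r < 1\<close>, and reduces the second one to the previous lemma.\<close>
  let ?N = "real DIM('a) + a"
  let ?F = "\<lambda>t. - (t powr - a) * (ln (t / r) / a + 1 / a\<^sup>2)"
  have "has_bochner_integral lborel
    (\<lambda>z::'a. indicator {z. r < norm z} z * (ln (norm z / r) / norm z powr ?N))
    (sphere_area DIM('a) * - ?F r)"
  proof (rule has_bochner_integral_radial_tail[where g = "\<lambda>t. ln (t / r) / t powr ?N" and F = ?F, OF _ assms(1)])
    fix t assume "r \<le> t"
    then have t: "0 < t" using assms by simp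
    have e: "ln (t / r) / t powr ?N * t ^ (DIM('a) - 1) = ln (t / r) * t powr (- a - 1)"
      using t by (simp add: powr_realpow [symmetric] powr_diff powr_add powr_minus field_simps of_nat_diff)
    show "(?F has_real_derivative ln (t / r) / t powr ?N * t ^ (DIM('a) - 1)) (at t)"
      unfolding e using t assms
      by (auto intro!: derivative_eq_intros simp: powr_diff field_simps power2_eq_square)
    show "0 \<le> ln (t / r) / t powr ?N"
      using \<open>r \<le> t\<close> assms by simp
  next
    have P: "filterlim (\<lambda>t::real. t powr a) at_top at_top"
    proof (rule filterlim_cong[THEN iffD1, OF refl refl])
      show "filterlim (\<lambda>t::real. exp (a * ln t)) at_top at_top"
        using assms
        by (intro filterlim_compose[OF exp_at_top] filterlim_tendsto_pos_mult_at_top[OF tendsto_const _ ln_at_top])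
      show "\<forall>\<^sub>F t in at_top. exp (a * ln t) = t powr a"
        using eventually_gt_at_top[of "0::real"] by eventually_elim (simp add: powr_def)
    qed
    have "((\<lambda>t. ln (t powr a) / t powr a) \<longlongrightarrow> 0) at_top"
      by (rule filterlim_compose[OF ln_x_over_x_tendsto_0 P])
    moreover have "((\<lambda>t::real. t powr - a) \<longlongrightarrow> 0) at_top"
      using assms by (intro tendsto_neg_powr filterlim_ident) auto
    ultimately have "((\<lambda>t. - ((ln (t powr a) / t powr a) / a\<^sup>2 + t powr - a * (1 / a\<^sup>2 - ln r / a)))
        \<longlongrightarrow> - (0 / a\<^sup>2 + 0 * (1 / a\<^sup>2 - ln r / a))) at_top"
      using assms by (intro tendsto_intros) auto
    moreover have "\<forall>\<^sub>F t in at_top. - ((ln (t powr a) / t powr a) / a\<^sup>2 + t powr - a * (1 / a\<^sup>2 - ln r / a)) = ?F t"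
      using eventually_gt_at_top[of "0::real"]
    proof eventually_elim
      case (elim t)
      then have "ln (t powr a) / t powr a = t powr - a * (a * ln t)"
        by (simp add: ln_powr powr_minus divide_inverse)
      then show ?case
        using elim assms by (simp add: ln_div field_simps power2_eq_square)
    qed
    ultimately show "(?F \<longlongrightarrow> 0) at_top"
      by (simp add: tendsto_cong)
  qed auto
  from has_bochner_integral_add[OF this has_bochner_integral_mult_right[OF radial_tail_powr[OF assms, where 'a='a], of "ln r"]]
  have "has_bochner_integral lborel
    (\<lambda>z::'a. indicator {z. r < norm z} z * (ln (norm z / r) / norm z powr ?N) +
       ln r * (indicator {z. r < norm z} z * (1 / norm z powr ?N)))
    (sphere_area DIM('a) * r powr - a * (ln r / a + 1 / a\<^sup>2))"
    using assms by (simp add: algebra_simps)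
  moreover have "indicator {z. r < norm z} z * (ln (norm z / r) / norm z powr ?N) +
       ln r * (indicator {z. r < norm z} z * (1 / norm z powr ?N)) =
     indicator {z. r < norm z} z * (ln (norm z) / norm z powr ?N)" for z :: 'a
    using assms by (auto split: split_indicator simp: ln_div diff_divide_distrib)
  ultimately show ?thesis by simp
qed

section \<open>Energies with an integrable kernel\<close>

lemma abs_diff_powr_le:
  fixes a b p :: real
  assumes "1 \<le> p"
  shows "\<bar>a - b\<bar> powr p \<le> 2 powr (p - 1) * (\<bar>a\<bar> powr p + \<bar>b\<bar> powr p)"
proof (cases "a = 0 \<or> b = 0")
  case True
  have "1 \<le> (2::real) powr (p - 1)" using assms by (simp add: ge_one_powr_ge_zero)
  then show ?thesis using True
    by (auto intro: order_trans[OF _ mult_right_mono[OF \<open>1 \<le> 2 powr (p - 1)\<close>]])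
next
  case False
  have "\<bar>a - b\<bar> powr p \<le> (\<bar>a\<bar> + \<bar>b\<bar>) powr p"
    using assms by (intro powr_mono2) auto
  also have "\<dots> = 2 powr p * ((1 - 1/2) *\<^sub>R \<bar>a\<bar> + (1/2) *\<^sub>R \<bar>b\<bar>) powr p"
    by (subst powr_mult [symmetric]) (auto simp: algebra_simps)
  also have "\<dots> \<le> 2 powr p * ((1 - 1/2) * \<bar>a\<bar> powr p + (1/2) * \<bar>b\<bar> powr p)"
    using False by (intro mult_left_mono convex_onD[OF powr_convex[OF assms]]) auto
  also have "\<dots> = 2 powr (p - 1) * (\<bar>a\<bar> powr p + \<bar>b\<bar> powr p)"
    by (simp add: powr_diff field_simps)
  finally show ?thesis .
qed

lemma has_bochner_integral_reflect:
  fixes k :: "'a::euclidean_space \<Rightarrow> real"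
  assumes "has_bochner_integral lborel k c"
  shows "has_bochner_integral lborel (\<lambda>y. k (x - y)) c"
proof -
  have k[measurable]: "k \<in> borel_measurable borel"
    using assms by (auto simp: has_bochner_integral_iff dest: borel_measurable_integrable)
  have "distr lborel borel (\<lambda>y. x - y) = (lborel :: 'a measure)"
    using lborel_affine[of "-1" x] by (simp add: density_1)
  with assms have "has_bochner_integral (distr lborel borel (\<lambda>y. x - y)) k c"
    by simp
  then show ?thesis
    by (simp add: has_bochner_integral_iff integrable_distr_eq integral_distr)
qed

text \<open>
  Fubini's theorem in its order \<open>dy dx\<close>, where translation invariance makes the inner integral \<open>f
  x * c\<close>. The kernel may change sign.
\<close>

lemma has_bochner_integral_mult_kernel:
  fixes f k :: "'a::euclidean_space \<Rightarrow> real"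
  assumes f: "integrable lborel f" and k: "has_bochner_integral lborel k c"
  shows "has_bochner_integral lborel (\<lambda>(x, y). f x * k (x - y)) (integral\<^sup>L lborel f * c)"
proof -
  have [measurable]: "f \<in> borel_measurable borel" "k \<in> borel_measurable borel"
    using f k by (auto simp: has_bochner_integral_iff dest: borel_measurable_integrable)
  have kx: "has_bochner_integral lborel (\<lambda>y. f x * k (x - y)) (f x * c)" for x
    by (intro has_bochner_integral_mult_right has_bochner_integral_reflect k)
  have "has_bochner_integral lborel (\<lambda>z. \<bar>k z\<bar>) (\<integral>z. \<bar>k z\<bar> \<partial>lborel)"
    using k by (simp add: has_bochner_integral_iff)
  from has_bochner_integral_integral_eq[OF has_bochner_integral_reflect[OF this]]
  have nk: "(\<integral>y. \<bar>k (x - y)\<bar> \<partial>lborel) = (\<integral>z. \<bar>k z\<bar> \<partial>lborel)" for x .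
  have int: "integrable (lborel \<Otimes>\<^sub>M lborel) (\<lambda>(x, y). f x * k (x - y))"
  proof (rule lborel_pair.Fubini_integrable)
    show "integrable lborel (\<lambda>x. \<integral>y. norm (case (x, y) of (x, y) \<Rightarrow> f x * k (x - y)) \<partial>lborel)"
      using f by (simp add: abs_mult nk)
    show "AE x in lborel. integrable lborel (\<lambda>y. case (x, y) of (x, y) \<Rightarrow> f x * k (x - y))"
      using kx by (simp add: has_bochner_integral_iff)
  qed measurable
  have "integral\<^sup>L (lborel \<Otimes>\<^sub>M lborel) (\<lambda>(x, y). f x * k (x - y)) =
      (\<integral>x. \<integral>y. f x * k (x - y) \<partial>lborel \<partial>lborel)"
    using lborel_pair.integral_fst'[OF int] by simp
  also have "\<dots> = integral\<^sup>L lborel f * c"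
    by (simp add: has_bochner_integral_integral_eq[OF has_bochner_integral_reflect[OF k]])
  finally show ?thesis
    using int by (simp add: has_bochner_integral_iff lborel_prod)
qed

lemma has_bochner_integral_swap:
  fixes g :: "'a::euclidean_space \<Rightarrow> 'a \<Rightarrow> real"
  assumes "has_bochner_integral lborel (\<lambda>(x, y). g x y) c"
  shows "has_bochner_integral lborel (\<lambda>(x, y). g y x) c"
proof -
  have int: "integrable (lborel \<Otimes>\<^sub>M lborel) (\<lambda>(x, y). g x y)"
    using assms by (simp add: has_bochner_integral_iff lborel_prod)
  have "integrable (lborel \<Otimes>\<^sub>M lborel) (\<lambda>(x, y). g y x)"
    using lborel_pair.integrable_product_swap[OF int] by simp
  moreover have "integral\<^sup>L (lborel \<Otimes>\<^sub>M lborel) (\<lambda>(x, y). g y x) =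
      integral\<^sup>L (lborel \<Otimes>\<^sub>M lborel) (\<lambda>(x, y). g x y)"
    using lborel_pair.integral_product_swap[OF borel_measurable_integrable[OF int]] by simp
  ultimately show ?thesis
    using assms by (simp add: has_bochner_integral_iff lborel_prod)
qed

text \<open>
  On the diagonal \<open>u = v\<close> the density is a \<open>p\<close>-th power of the increment. Equal values need a
  separate check, as the exponent \<open>p - 2\<close> may be negative; both sides are then \<open>0\<close>.
\<close>

lemma energy_density_diag:
  "energy_density p k v v z = \<bar>v (fst z) - v (snd z)\<bar> powr p * k (fst z - snd z)"
proof -
  have "\<bar>d\<bar> powr (p - 2) * d * d = \<bar>d\<bar> powr p" for d :: real
  proof (cases "d = 0")
    case False
    then show ?thesis
      using powr_add[of "\<bar>d\<bar>" "p - 2" 2] by (simp add: power2_eq_square mult.assoc)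
  qed simp
  then show ?thesis
    by (simp add: energy_density_def case_prod_beta)
qed

lemma energy_density_measurable [measurable]:
  fixes v k :: "'a::euclidean_space \<Rightarrow> real"
  assumes [measurable]: "v \<in> borel_measurable borel" "k \<in> borel_measurable borel"
  shows "energy_density p k v v \<in> borel_measurable borel"
  unfolding energy_density_def borel_prod[symmetric] by measurable

text \<open>
  Convexity separates the two variables, and each of the two resulting terms is a mass times the
  integral of the kernel.
\<close>

lemma energy_density_integrable_kernel:
  fixes v k :: "'a::euclidean_space \<Rightarrow> real"
  assumes "1 \<le> p" and [measurable]: "v \<in> borel_measurable borel"
    and v: "integrable lborel (\<lambda>x. \<bar>v x\<bar> powr p)"
    and k: "has_bochner_integral lborel k c" "\<And>z. 0 \<le> k z" "\<And>z. k (- z) = k z"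
  shows "integrable lborel (energy_density p k v v)"
    and "(\<integral>z. energy_density p k v v z \<partial>lborel) \<le> 2 powr p * (\<integral>x. \<bar>v x\<bar> powr p \<partial>lborel) * c"
proof -
  have [measurable]: "k \<in> borel_measurable borel"
    using k by (auto simp: has_bochner_integral_iff dest: borel_measurable_integrable)
  let ?A = "\<integral>x. \<bar>v x\<bar> powr p \<partial>lborel"
  let ?B = "\<lambda>z. 2 powr (p - 1) *
    (\<bar>v (fst z)\<bar> powr p * k (fst z - snd z) + \<bar>v (snd z)\<bar> powr p * k (snd z - fst z))"
  have x: "has_bochner_integral lborel (\<lambda>(x, y). \<bar>v x\<bar> powr p * k (x - y)) (?A * c)"
    by (rule has_bochner_integral_mult_kernel[OF v k(1)])
  have y: "has_bochner_integral lborel (\<lambda>(x, y). \<bar>v y\<bar> powr p * k (y - x)) (?A * c)"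
    by (rule has_bochner_integral_swap[OF x])
  have sym: "k (y - x) = k (x - y)" for x y
    using k(3)[of "x - y"] by simp
  have bound: "has_bochner_integral lborel ?B (2 powr (p - 1) * (?A * c + ?A * c))"
    using has_bochner_integral_mult_right[OF has_bochner_integral_add[OF x y], of "2 powr (p - 1)"]
    by (simp add: case_prod_beta)
  have le: "energy_density p k v v z \<le> ?B z" for z
    using mult_right_mono[OF abs_diff_powr_le[OF assms(1), of "v (fst z)" "v (snd z)"] k(2)[of "fst z - snd z"]]
    by (simp add: energy_density_diag case_prod_beta sym algebra_simps)
  have nonneg: "0 \<le> energy_density p k v v z" for z
    using k(2) by (simp add: energy_density_diag)
  show int: "integrable lborel (energy_density p k v v)"
  proof (rule Bochner_Integration.integrable_bound)
    show "integrable lborel ?B"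
      using bound by (simp add: has_bochner_integral_iff)
    show "AE z in lborel. norm (energy_density p k v v z) \<le> norm (?B z)"
      using le nonneg by (intro always_eventually allI) (metis abs_of_nonneg order_trans real_norm_def)
  qed simp
  have "(\<integral>z. energy_density p k v v z \<partial>lborel) \<le> 2 powr (p - 1) * (?A * c + ?A * c)"
    by (subst has_bochner_integral_integral_eq[OF bound, symmetric],
        rule integral_mono[OF int _ le]) (use bound in \<open>simp add: has_bochner_integral_iff\<close>)
  also have "\<dots> = 2 powr p * ?A * c"
    by (simp add: powr_diff)
  finally show "(\<integral>z. energy_density p k v v z \<partial>lborel) \<le> 2 powr p * ?A * c" .
qed

section \<open>Null sets, diameters and signs\<close>

lemma AE_lborel_pair_both:
  fixes P :: "'a::euclidean_space \<Rightarrow> bool"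
  assumes "AE x in lborel. P x"
  shows "AE z in lborel. P (fst z) \<and> P (snd z)"
proof -
  obtain N where N: "{x. \<not> P x} \<subseteq> N" "N \<in> sets lborel" "emeasure lborel N = 0"
    using assms by (auto elim!: AE_E)
  have [measurable]: "N \<in> sets borel"
    using N by simp
  have N0: "AE x in lborel. x \<notin> N"
    using N by (intro AE_not_in) auto
  have "AE z in lborel \<Otimes>\<^sub>M lborel. fst z \<notin> N \<and> snd z \<notin> N"
  proof (rule lborel_pair.AE_pair_measure)
    show "AE x in lborel. AE y in lborel. fst (x, y) \<notin> N \<and> snd (x, y) \<notin> N"
      using N0 by eventually_elim (use N0 in \<open>auto elim!: eventually_mono\<close>)
  qed measurable
  then have "AE z in lborel. fst z \<notin> N \<and> snd z \<notin> N"
    by (simp only: lborel_prod)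
  then show ?thesis
    by eventually_elim (use N in auto)
qed

lemma AE_lborel_ball_obtain:
  fixes c :: "'a::euclidean_space"
  assumes "AE y in lborel. P y" "0 < e"
  obtains y where "y \<in> ball c e" "P y"
proof -
  have "\<exists>y \<in> ball c e. P y"
  proof (rule ccontr)
    assume "\<not> ?thesis"
    with assms(1) have "AE y in lborel. y \<notin> ball c e"
      by (auto elim!: eventually_mono)
    then have "emeasure lborel (ball c e) = 0"
      by (subst (asm) AE_iff_measurable[where N = "ball c e"]) auto
    moreover have "0 < unit_ball_vol DIM('a) * e ^ DIM('a)"
      using assms by simp
    ultimately show False
      using assms by (simp add: emeasure_ball)
  qed
  then show ?thesis using that by blast
qed

lemma diameter_open_pos:
  fixes \<Omega> :: "'a::euclidean_space set"
  assumes "open \<Omega>" "bounded \<Omega>" "\<Omega> \<noteq> {}"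
  shows "0 < diameter \<Omega>"
proof -
  obtain x e where "0 < e" "ball x e \<subseteq> \<Omega>"
    using assms by (meson ex_in_conv open_contains_ball)
  then show ?thesis
    using diameter_subset[of "ball x e" \<Omega>] assms by auto
qed

text \<open>
  A ball of radius \<open>diameter \<Omega>\<close> is too wide to be covered by \<open>\<Omega>\<close> up to a null set: such a cover
  would contain points near both ends of a diameter of the ball.
\<close>

lemma not_AE_ball_diameter_subset:
  fixes \<Omega> :: "'a::euclidean_space set"
  assumes "bounded \<Omega>" and d: "0 < diameter \<Omega>"
  shows "\<not> (AE y in lborel. dist x y \<le> diameter \<Omega> \<longrightarrow> y \<in> \<Omega>)"
proof
  let ?d = "diameter \<Omega>"
  assume AE: "AE y in lborel. dist x y \<le> ?d \<longrightarrow> y \<in> \<Omega>"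
  obtain b :: 'a where b: "b \<in> Basis"
    using nonempty_Basis by blast
  \<comment> \<open>Points within \<open>?d / 8\<close> of \<open>x + ?h\<close> and of \<open>x - ?h\<close> stay in the ball of radius \<open>?d\<close> about \<open>x\<close> and
    have distance at least \<open>(3/2 - 1/4) * ?d > ?d\<close> from each other.\<close>
  let ?h = "(3/4 * ?d) *\<^sub>R b"
  obtain y1 where y1: "y1 \<in> ball (x + ?h) (?d / 8)" "dist x y1 \<le> ?d \<longrightarrow> y1 \<in> \<Omega>"
    using AE_lborel_ball_obtain[OF AE, of "?d / 8" "x + ?h"] d by auto
  obtain y2 where y2: "y2 \<in> ball (x - ?h) (?d / 8)" "dist x y2 \<le> ?d \<longrightarrow> y2 \<in> \<Omega>"
    using AE_lborel_ball_obtain[OF AE, of "?d / 8" "x - ?h"] d by auto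
  have h: "dist x (x + ?h) = 3/4 * ?d" "dist x (x - ?h) = 3/4 * ?d" "dist (x + ?h) (x - ?h) = 3/2 * ?d"
    using b d by (simp_all add: dist_norm scaleR_add_left [symmetric])
  have "dist x y1 \<le> ?d" "dist x y2 \<le> ?d"
    using y1 y2 h dist_triangle[of x y1 "x + ?h"] dist_triangle[of x y2 "x - ?h"] d by auto
  then have "dist y1 y2 \<le> ?d"
    using y1 y2 assms by (intro diameter_bounded_bound) auto
  moreover have "dist (x + ?h) (x - ?h) \<le> dist (x + ?h) y1 + dist y1 y2 + dist y2 (x - ?h)"
        using dist_triangle[of "x + ?h" "x - ?h" y1] dist_triangle[of y1 "x - ?h" y2] by linarith
  ultimately show False
    using y1 y2 h d by (auto simp: dist_commute)
qed

text \<open>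
  If \<open>v\<close> is positive on a set of positive measure, then by Fubini some \<open>x\<close> in that set satisfies
  \<open>v x * v y \<ge> 0\<close> for almost every \<open>y\<close>.
\<close>

lemma AE_sign_of_AE_product_nonneg:
  fixes v :: "'a::euclidean_space \<Rightarrow> real"
  assumes "AE z in lborel. 0 \<le> v (fst z) * v (snd z)"
  shows "(AE x in lborel. 0 \<le> v x) \<or> (AE x in lborel. v x \<le> 0)"
proof -
  have AE: "AE x in lborel. AE y in lborel. 0 \<le> v x * v y"
    using lborel_pair.AE_pair[of "\<lambda>z. 0 \<le> v (fst z) * v (snd z)"] assms
    by (simp only: lborel_prod fst_conv snd_conv)
  show ?thesis
  proof (rule disjCI)
    assume "\<not> (AE x in lborel. v x \<le> 0)"
    moreover have "AE x in lborel. v x \<le> 0" if "\<And>x. AE y in lborel. 0 \<le> v x * v y \<Longrightarrow> v x \<le> 0"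
      using AE by (rule eventually_mono) (rule that)
    ultimately obtain x where "0 < v x" "AE y in lborel. 0 \<le> v x * v y"
      by (meson not_le)
    then show "AE x in lborel. 0 \<le> v x"
      by (auto simp: zero_le_mult_iff elim!: eventually_mono)
  qed
qed

section \<open>The kernels\<close>

lemma C_const_pos: "0 < n \<Longrightarrow> 0 < s \<Longrightarrow> s < 1 \<Longrightarrow> 0 < p \<Longrightarrow> 0 < C_const n s p"
  unfolding C_const_def
  by (auto intro!: divide_pos_pos mult_pos_pos Gamma_real_pos add_pos_pos)

text \<open>
  The kernel of \<open>J_pos - J_neg\<close>: positive on the punctured unit ball and negative outside the
  closed ball.
\<close>

definition log_kernel :: "real \<Rightarrow> real \<Rightarrow> 'a::euclidean_space \<Rightarrow> real" where
  "log_kernel s p z = C_const DIM('a) s p * - ln (norm z) / norm z powr (real DIM('a) + s * p)"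

lemma log_kernel_measurable [measurable]:
  "log_kernel_pos s p \<in> borel_measurable borel" "log_kernel_neg s p \<in> borel_measurable borel"
  "log_kernel s p \<in> borel_measurable borel" "frac_kernel s p \<in> borel_measurable borel"
  unfolding log_kernel_pos_def log_kernel_neg_def log_kernel_def frac_kernel_def by measurable

lemma log_kernel_minus [simp]:
  "log_kernel_pos s p (- z) = log_kernel_pos s p z" "log_kernel_neg s p (- z) = log_kernel_neg s p z"
  "log_kernel s p (- z) = log_kernel s p z" "frac_kernel s p (- z) = frac_kernel s p z"
  by (simp_all add: log_kernel_pos_def log_kernel_neg_def log_kernel_def frac_kernel_def)

lemma frac_kernel_nonneg: "0 \<le> frac_kernel s p z"
  by (simp add: frac_kernel_def)

lemma log_kernel_eq_diff: "log_kernel s p z = log_kernel_pos s p z - log_kernel_neg s p z"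
  by (simp add: log_kernel_def log_kernel_pos_def log_kernel_neg_def max_def diff_divide_distrib [symmetric])

lemma log_kernel_neg_alt:
  fixes z :: "'a::euclidean_space"
  shows "log_kernel_neg s p z =
    C_const DIM('a) s p * (indicator {z. 1 < norm z} z * (ln (norm z) / norm z powr (real DIM('a) + s * p)))"
proof (cases "z = 0")
  case False
  then show ?thesis
    by (auto simp: log_kernel_neg_def max_def split: split_indicator)
qed (simp add: log_kernel_neg_def)

locale slog_exponents =
  fixes s p :: real
  assumes p: "1 < p" and s: "0 < s" "s < 1"
begin

lemma sp: "0 < s * p"
  using p s by simp

lemma C_pos: "0 < C_const DIM('a::euclidean_space) s p"
  using p s by (intro C_const_pos) auto

lemma log_kernel_pos_nonneg: "0 \<le> log_kernel_pos s p (z :: 'a::euclidean_space)"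
  using C_pos[where 'a='a] by (simp add: log_kernel_pos_def)

lemma log_kernel_neg_nonneg: "0 \<le> log_kernel_neg s p (z :: 'a::euclidean_space)"
  using C_pos[where 'a='a] by (simp add: log_kernel_neg_def)

lemma log_kernel_nonneg: "norm (z :: 'a::euclidean_space) \<le> 1 \<Longrightarrow> 0 \<le> log_kernel s p z"
  using C_pos[where 'a='a]
  by (cases "z = 0") (auto simp: log_kernel_def intro!: divide_nonpos_nonneg mult_nonneg_nonpos)

lemma log_kernel_pos_near: "z \<noteq> 0 \<Longrightarrow> norm (z :: 'a::euclidean_space) < 1 \<Longrightarrow> 0 < log_kernel s p z"
  using C_pos[where 'a='a] by (auto simp: log_kernel_def intro!: mult_pos_neg divide_neg_pos)

lemma has_bochner_integral_log_kernel_neg: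
  "has_bochner_integral lborel (log_kernel_neg s p :: 'a::euclidean_space \<Rightarrow> real)
     (sphere_area DIM('a) / (s * p)\<^sup>2 * C_const DIM('a) s p)"
  using has_bochner_integral_mult_right[OF radial_tail_ln[OF zero_less_one sp, where 'a='a], of "C_const DIM('a) s p"]
  by (simp add: log_kernel_neg_alt [abs_def] mult_ac)

text \<open>
  For \<open>d < 1\<close> this integral has contributions of both signs; they balance exactly at \<open>d = exp (- 1
  / (s * p))\<close>, which is the threshold on the diameter.
\<close>

lemma has_bochner_integral_log_kernel_far:
  assumes "0 < d"
  shows "has_bochner_integral lborel (\<lambda>z :: 'a::euclidean_space. indicator {z. d < norm z} z * log_kernel s p z)
     (- (sphere_area DIM('a) / (s * p) * C_const DIM('a) s p * d powr - (s * p) * (ln d + 1 / (s * p))))"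
proof -
  have e: "- C_const DIM('a) s p * (sphere_area DIM('a) * d powr - (s * p) * (ln d / (s * p) + 1 / (s * p)\<^sup>2)) =
     - (sphere_area DIM('a) / (s * p) * C_const DIM('a) s p * d powr - (s * p) * (ln d + 1 / (s * p)))"
    by (simp add: algebra_simps add_divide_distrib power2_eq_square)
  show ?thesis
    using has_bochner_integral_mult_right[OF radial_tail_ln[OF assms sp, where 'a='a], of "- C_const DIM('a) s p"]
    unfolding e by (simp add: log_kernel_def [abs_def] mult_ac)
qed

lemma has_bochner_integral_frac_kernel_far:
  assumes "0 < r"
  shows "has_bochner_integral lborel (\<lambda>z :: 'a::euclidean_space. indicator {z. r < norm z} z * frac_kernel s p z)
     (sphere_area DIM('a) / (s * p) * r powr - (s * p))"
  using radial_tail_powr[OF assms sp, where 'a='a] by (simp add: frac_kernel_def)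

text \<open>
  Inside the ball of radius \<open>r\<close> the positive logarithmic kernel divided by the fractional one is
  \<open>C * - ln (norm z) \<ge> C * - ln r\<close>.
\<close>

lemma frac_kernel_le:
  assumes "0 < r" "r < 1"
  shows "frac_kernel s p (z :: 'a::euclidean_space) \<le>
    - (1 / (C_const DIM('a) s p * ln r)) * log_kernel_pos s p z + indicator {z. r < norm z} z * frac_kernel s p z"
proof (cases "z = 0 \<or> r < norm z")
  case True
  moreover have "0 \<le> - (1 / (C_const DIM('a) s p * ln r)) * log_kernel_pos s p z"
    using assms C_pos[where 'a='a] log_kernel_pos_nonneg[of z]
    by (intro mult_nonneg_nonneg) (auto simp: divide_le_0_iff mult_le_0_iff)
  ultimately show ?thesis
    by (auto simp: frac_kernel_def)
next
  case False
  then have z: "0 < norm z" "norm z \<le> r" by auto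
  then have l: "ln (norm z) \<le> ln r" "ln r < 0"
    using assms by auto
  then have "- (1 / (C_const DIM('a) s p * ln r)) * log_kernel_pos s p z = (ln (norm z) / ln r) * frac_kernel s p z"
    using C_pos[where 'a='a] by (simp add: log_kernel_pos_def frac_kernel_def max_def field_simps)
  moreover have "1 \<le> ln (norm z) / ln r"
    using l by (simp add: le_divide_eq)
  ultimately show ?thesis
    using mult_right_mono[of 1 "ln (norm z) / ln r" "frac_kernel s p z"] frac_kernel_nonneg[of s p z] False
    by simp
qed

end

section \<open>Energies of a Borel function supported in the domain\<close>

text \<open>
  Borel representatives of the elements of \<open>W_slog_0 s p \<Omega>\<close>, normalised to vanish at every point
  outside \<open>\<Omega>\<close>, so that case distinctions on membership in \<open>\<Omega>\<close> hold pointwise.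
\<close>

locale slog_function = slog_exponents s p for s p :: real +
  fixes \<Omega> :: "'a::euclidean_space set" and v :: "'a \<Rightarrow> real"
  assumes open_domain: "open \<Omega>" and bounded_domain: "bounded \<Omega>"
    and borel [measurable]: "v \<in> borel_measurable borel"
    and outside: "\<And>x. x \<notin> \<Omega> \<Longrightarrow> v x = 0"
    and Lp: "integrable lborel (\<lambda>x. \<bar>v x\<bar> powr p)"
    and pos_integrable: "integrable lborel (energy_density p (log_kernel_pos s p) v v)"
begin

abbreviation energy :: "('a \<Rightarrow> real) \<Rightarrow> real" where
  "energy k \<equiv> (\<integral>z. energy_density p k v v z \<partial>lborel)"

abbreviation mass :: real where
  "mass \<equiv> (\<integral>x. \<bar>v x\<bar> powr p \<partial>lborel)"

abbreviation d :: real where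
  "d \<equiv> diameter \<Omega>"

lemma neg_integrable: "integrable lborel (energy_density p (log_kernel_neg s p) v v)"
  and neg_le: "energy (log_kernel_neg s p) \<le>
    2 powr p * mass * (sphere_area DIM('a) / (s * p)\<^sup>2 * C_const DIM('a) s p)"
  using p energy_density_integrable_kernel[OF _ borel Lp has_bochner_integral_log_kernel_neg log_kernel_neg_nonneg]
  by auto

lemma energy_nonneg: "(\<And>z. 0 \<le> k z) \<Longrightarrow> 0 \<le> energy k"
  by (intro integral_nonneg_AE always_eventually) (simp add: energy_density_diag)

lemma frac_integrable_and_le:
  assumes r: "0 < r" "r < 1"
  shows "integrable lborel (energy_density p (frac_kernel s p) v v)"
    and "energy (frac_kernel s p) \<le>
      - (1 / (C_const DIM('a) s p * ln r)) * energy (log_kernel_pos s p) +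
      2 powr p * mass * (sphere_area DIM('a) / (s * p) * r powr - (s * p))"
proof -
  let ?c = "- (1 / (C_const DIM('a) s p * ln r))"
  let ?far = "\<lambda>z :: 'a. indicator {z. r < norm z} z * frac_kernel s p z"
  let ?B = "\<lambda>z. ?c * energy_density p (log_kernel_pos s p) v v z + energy_density p ?far v v z"
  have far: "integrable lborel (energy_density p ?far v v)"
    "energy ?far \<le> 2 powr p * mass * (sphere_area DIM('a) / (s * p) * r powr - (s * p))"
    using p energy_density_integrable_kernel[OF _ borel Lp has_bochner_integral_frac_kernel_far[OF r(1)]]
    by (auto simp: frac_kernel_nonneg indicator_def)
  have B: "integrable lborel ?B"
    by (intro Bochner_Integration.integrable_add integrable_mult_right pos_integrable far)
  have le: "energy_density p (frac_kernel s p) v v z \<le> ?B z" for z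
    using mult_left_mono[OF frac_kernel_le[OF r, of "fst z - snd z"], of "\<bar>v (fst z) - v (snd z)\<bar> powr p"]
    by (simp add: energy_density_diag algebra_simps)
  show int: "integrable lborel (energy_density p (frac_kernel s p) v v)"
  proof (rule Bochner_Integration.integrable_bound[OF B])
    have "0 \<le> energy_density p (frac_kernel s p) v v z" for z
      by (simp add: energy_density_diag frac_kernel_nonneg)
    with le show "AE z in lborel. norm (energy_density p (frac_kernel s p) v v z) \<le> norm (?B z)"
      by (intro always_eventually allI) (metis abs_of_nonneg order_trans real_norm_def)
  qed simp
  have "energy (frac_kernel s p) \<le> (\<integral>z. ?B z \<partial>lborel)"
    by (rule integral_mono[OF int B le])
  also have "\<dots> = ?c * energy (log_kernel_pos s p) + energy ?far"
    by (subst Bochner_Integration.integral_add) (auto intro: pos_integrable far)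
  finally show "energy (frac_kernel s p) \<le> ?c * energy (log_kernel_pos s p) +
      2 powr p * mass * (sphere_area DIM('a) / (s * p) * r powr - (s * p))"
    using far(2) by linarith
qed

lemma log_integrable: "integrable lborel (energy_density p (log_kernel s p) v v)"
  and log_energy: "energy (log_kernel s p) = energy (log_kernel_pos s p) - energy (log_kernel_neg s p)"
proof -
  have e: "energy_density p (log_kernel s p) v v =
      (\<lambda>z. energy_density p (log_kernel_pos s p) v v z - energy_density p (log_kernel_neg s p) v v z)"
    by (auto simp: energy_density_diag log_kernel_eq_diff algebra_simps)
  show "integrable lborel (energy_density p (log_kernel s p) v v)"
    "energy (log_kernel s p) = energy (log_kernel_pos s p) - energy (log_kernel_neg s p)"
    unfolding e by (simp_all add: pos_integrable neg_integrable)
qed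

definition slog_energy :: real where
  "slog_energy = p / 2 * (energy (log_kernel_pos s p) - energy (log_kernel_neg s p)) +
     B_const DIM('a) s p * C_const DIM('a) s p / 2 * energy (frac_kernel s p)"

lemma slog_energy_alt:
  "slog_energy = p / 2 * energy (log_kernel s p) +
     B_const DIM('a) s p * C_const DIM('a) s p / 2 * energy (frac_kernel s p)"
  by (simp add: slog_energy_def log_energy)

text \<open>
  The exact contribution to \<open>energy (log_kernel s p)\<close> of the pairs with one point in \<open>\<Omega>\<close> and the
  other at distance greater than \<open>d\<close> from it. The factor \<open>2\<close> counts both orders.
\<close>

definition far_energy :: real where
  "far_energy = - (2 * sphere_area DIM('a) / (s * p) * C_const DIM('a) s p *
     d powr - (s * p) * (ln d + 1 / (s * p)) * mass)"

text \<open>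
  The case \<open>d = 0\<close>, which occurs for the empty domain, has \<open>far_energy = 0\<close> because \<open>0 powr x =
  0\<close>.
\<close>

lemma far_energy_nonneg: "d \<le> exp (- (1 / (s * p))) \<Longrightarrow> 0 \<le> far_energy"
proof (cases "d \<le> 0")
  case False
  assume "d \<le> exp (- (1 / (s * p)))"
  then have "ln d \<le> - (1 / (s * p))"
    using False ln_le_cancel_iff[of d "exp (- (1 / (s * p)))"] by simp
  moreover have "0 \<le> 2 * sphere_area DIM('a) / (s * p) * C_const DIM('a) s p * d powr - (s * p)"
    using sp C_pos[where 'a='a] sphere_area_pos[of "DIM('a)"] by simp
  moreover have "0 \<le> mass"
    by (simp add: integral_nonneg_AE)
  ultimately show ?thesis
    unfolding far_energy_def neg_0_le_iff_le by (intro mult_nonpos_nonneg mult_nonneg_nonpos) auto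
qed (use diameter_ge_0[OF bounded_domain] in \<open>simp add: far_energy_def\<close>)

lemma diameter_less_1: "d \<le> exp (- (1 / (s * p))) \<Longrightarrow> d < 1"
  using sp by (smt (verit) divide_pos_pos one_less_exp_iff exp_less_one_iff)

text \<open>
  The pairs \<open>(x, y)\<close> with \<open>x \<in> \<Omega>\<close> and \<open>y \<notin> \<Omega>\<close> at distance at most \<open>d\<close>. The lower bound by
  \<open>far_energy\<close> drops them, but they are what makes the energy definite.
\<close>

definition near_density :: "'a \<times> 'a \<Rightarrow> real" where
  "near_density = (\<lambda>(x, y). if y \<notin> \<Omega> \<and> dist x y \<le> d then \<bar>v x\<bar> powr p * log_kernel s p (x - y) else 0)"

text \<open>
  The remainder \<open>R\<close> is the density minus its far part in either order. Where both points lie in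
  \<open>\<Omega>\<close>, their distance is at most \<open>d\<close>, so there is no far part and the density itself is
  nonnegative. Where only the first lies in \<open>\<Omega>\<close>, the remainder equals the near density.
\<close>

lemma log_energy_near_far:
  assumes "\<Omega> \<noteq> {}" "d < 1"
  obtains R where "integrable lborel R" "(\<integral>z. R z \<partial>lborel) = energy (log_kernel s p) - far_energy"
    "\<And>z. 0 \<le> near_density z" "\<And>z. near_density z \<le> R z"
proof
  have d: "0 < d"
    using assms diameter_open_pos open_domain bounded_domain by blast
  let ?k = "\<lambda>z :: 'a. indicator {z. d < norm z} z * log_kernel s p z"
  let ?P = "\<lambda>(x, y). \<bar>v x\<bar> powr p * ?k (x - y)" and ?Q = "\<lambda>(x, y). \<bar>v y\<bar> powr p * ?k (y - x)"
  let ?R = "\<lambda>z. energy_density p (log_kernel s p) v v z - (?P z + ?Q z)"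
  let ?c = "- (sphere_area DIM('a) / (s * p) * C_const DIM('a) s p * d powr - (s * p) * (ln d + 1 / (s * p)))"
  have P: "has_bochner_integral lborel ?P (mass * ?c)"
    by (rule has_bochner_integral_mult_kernel[OF Lp has_bochner_integral_log_kernel_far[OF d]])
  have Q: "has_bochner_integral lborel ?Q (mass * ?c)"
    by (rule has_bochner_integral_swap[OF P])
  have "has_bochner_integral lborel ?R (energy (log_kernel s p) - (mass * ?c + mass * ?c))"
    by (intro has_bochner_integral_diff has_bochner_integral_add P Q)
      (simp add: has_bochner_integral_iff log_integrable)
  moreover have "mass * ?c + mass * ?c = far_energy"
  proof -
    have "m * - (w / a * c * x * y) + m * - (w / a * c * x * y) = - (2 * w / a * c * x * y * m)"
      for m w a c x y :: real
      by (simp add: mult_ac)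
    then show ?thesis
      unfolding far_energy_def .
  qed
  ultimately show "integrable lborel ?R" "(\<integral>z. ?R z \<partial>lborel) = energy (log_kernel s p) - far_energy"
    by (auto simp: has_bochner_integral_iff)
  fix z :: "'a \<times> 'a"
  obtain x y where z: "z = (x, y)" by fastforce
  have inside: "dist x y \<le> d" if "x \<in> \<Omega>" "y \<in> \<Omega>"
    using that bounded_domain by (intro diameter_bounded_bound)
  have k: "0 \<le> log_kernel s p (x - y)" if "dist x y \<le> d"
    using that assms by (intro log_kernel_nonneg) (auto simp: dist_norm)
  have sym: "norm (y - x) = norm (x - y)" "log_kernel s p (y - x) = log_kernel s p (x - y)"
    using log_kernel_minus(3)[of s p "x - y"] by (simp_all add: norm_minus_commute)
  show "0 \<le> near_density z"
    using k by (simp add: near_density_def z)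
  show "near_density z \<le> ?R z"
    using inside k p outside[of x] outside[of y]
    by (cases "x \<in> \<Omega>"; cases "y \<in> \<Omega>")
      (auto simp: near_density_def z energy_density_diag sym indicator_def dist_norm)
qed

lemma log_energy_ge:
  assumes "d < 1"
  shows "far_energy \<le> energy (log_kernel s p)"
proof (cases "\<Omega> = {}")
  case True
  then have "v x = 0" for x
    using outside by auto
  then show ?thesis
    by (simp add: far_energy_def energy_density_diag)
next
  case False
  obtain R where R: "(\<integral>z. R z \<partial>lborel) = energy (log_kernel s p) - far_energy"
    "\<And>z. 0 \<le> near_density z" "\<And>z. near_density z \<le> R z"
    by (rule log_energy_near_far[OF False assms]) blast
  have "0 \<le> R z" for z
    using R(2,3)[of z] by (rule order_trans)
  with R(1) show ?thesis
    using integral_nonneg_AE[of R lborel] by (simp add: always_eventually)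
qed

lemma log_energy_nonneg: "d \<le> exp (- (1 / (s * p))) \<Longrightarrow> 0 \<le> energy (log_kernel s p)"
  using log_energy_ge far_energy_nonneg diameter_less_1 by force

text \<open>
  Equality in the lower bound annihilates the near density. By Fubini, if \<open>v x \<noteq> 0\<close> for a typical
  point \<open>x\<close>, then almost every point at distance at most \<open>d\<close> from \<open>x\<close> belongs to \<open>\<Omega>\<close>.
\<close>

lemma log_energy_definite:
  assumes d: "d \<le> exp (- (1 / (s * p)))" and le: "energy (log_kernel s p) \<le> 0"
  shows "AE x in lborel. v x = 0"
proof (cases "\<Omega> = {}")
  case True
  then show ?thesis
    using outside by auto
next
  case False
  note d1 = diameter_less_1[OF d]
  have d0: "0 < d"
    using False diameter_open_pos open_domain bounded_domain by blast
  obtain R where R: "integrable lborel R" "(\<integral>z. R z \<partial>lborel) = energy (log_kernel s p) - far_energy"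
    and near: "\<And>z. 0 \<le> near_density z" "\<And>z. near_density z \<le> R z"
    by (rule log_energy_near_far[OF False d1]) blast
  have R0: "0 \<le> R z" for z
    using near[of z] by (rule order_trans)
  have "(\<integral>z. R z \<partial>lborel) = 0"
    using R(2) le far_energy_nonneg[OF d] integral_nonneg_AE[of R lborel] R0
    by (simp add: always_eventually)
  then have "AE z in lborel. R z = 0"
    using R(1) R0 by (subst (asm) integral_nonneg_eq_0_iff_AE) auto
  then have "AE z in lborel. near_density z = 0"
  proof eventually_elim
    case (elim z)
    then show ?case using near[of z] by linarith
  qed
  then have "AE z in (lborel :: 'a measure) \<Otimes>\<^sub>M (lborel :: 'a measure). near_density z = 0"
    by (simp only: lborel_prod)
  then have "AE x in lborel. AE y in lborel. near_density (x, y) = 0"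
    by (rule lborel_pair.AE_pair)
  then show ?thesis
  proof eventually_elim
    case (elim x)
    show "v x = 0"
    proof (rule ccontr)
      assume v: "v x \<noteq> 0"
      then have x: "x \<in> \<Omega>"
        using outside by blast
      from elim have "AE y in lborel. dist x y \<le> d \<longrightarrow> y \<in> \<Omega>"
      proof eventually_elim
        case (elim y)
        have "0 < log_kernel s p (x - y)" if "dist x y \<le> d" "y \<notin> \<Omega>"
          using that x d1 by (intro log_kernel_pos_near) (auto simp: dist_norm)
        with elim v show ?case
          by (auto simp: near_density_def split: if_splits)
      qed
      then show False
        using not_AE_ball_diameter_subset[OF bounded_domain d0] by blast
    qed
  qed
qed

lemma abs_density_le:
  assumes "\<And>z. 0 \<le> k z"
  shows "energy_density p k (\<lambda>x. \<bar>v x\<bar>) (\<lambda>x. \<bar>v x\<bar>) z \<le> energy_density p k v v z"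
  using assms p by (auto simp: energy_density_diag intro!: mult_right_mono powr_mono2)

lemma abs_slog_function: "slog_function s p \<Omega> (\<lambda>x. \<bar>v x\<bar>)"
proof
  show "integrable lborel (energy_density p (log_kernel_pos s p) (\<lambda>x. \<bar>v x\<bar>) (\<lambda>x. \<bar>v x\<bar>))"
  proof (rule Bochner_Integration.integrable_bound[OF pos_integrable])
    have "0 \<le> energy_density p (log_kernel_pos s p) (\<lambda>x. \<bar>v x\<bar>) (\<lambda>x. \<bar>v x\<bar>) z" for z
      by (simp add: energy_density_diag log_kernel_pos_nonneg)
    with abs_density_le[where k = "log_kernel_pos s p", OF log_kernel_pos_nonneg]
    show "AE z in lborel. norm (energy_density p (log_kernel_pos s p) (\<lambda>x. \<bar>v x\<bar>) (\<lambda>x. \<bar>v x\<bar>) z) \<le>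
        norm (energy_density p (log_kernel_pos s p) v v z)"
      by (intro always_eventually allI) (metis abs_of_nonneg order_trans real_norm_def)
  qed simp
qed (use open_domain bounded_domain outside Lp in auto)

interpretation abs: slog_function s p \<Omega> "\<lambda>x. \<bar>v x\<bar>"
  by (rule abs_slog_function)

text \<open>
  Although \<open>log_kernel\<close> changes sign, the comparison is pointwise: where the kernel is negative,
  at least one of the two values of \<open>v\<close> is \<open>0\<close>, and the two densities agree.
\<close>

lemma abs_log_density_le:
  assumes "d < 1"
  shows "energy_density p (log_kernel s p) (\<lambda>x. \<bar>v x\<bar>) (\<lambda>x. \<bar>v x\<bar>) z \<le> energy_density p (log_kernel s p) v v z"
proof (cases "fst z \<in> \<Omega> \<and> snd z \<in> \<Omega>")
  case True
  then have "dist (fst z) (snd z) \<le> d"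
    using bounded_domain by (intro diameter_bounded_bound) auto
  then have "0 \<le> log_kernel s p (fst z - snd z)"
    using assms by (intro log_kernel_nonneg) (auto simp: dist_norm)
  then show ?thesis
    using p by (auto simp: energy_density_diag intro!: mult_right_mono powr_mono2)
qed (use outside[of "fst z"] outside[of "snd z"] in \<open>auto simp: energy_density_diag\<close>)

text \<open>
  Ordered densities with equal integrals agree almost everywhere. The kernel is positive for
  distinct points of \<open>\<Omega>\<close>, so \<open>\<bar>\<bar>v x\<bar> - \<bar>v y\<bar>\<bar> = \<bar>v x - v y\<bar>\<close>, that is, \<open>v x\<close> and \<open>v y\<close> do not have
  opposite signs.
\<close>

lemma abs_log_energy_eq_imp_sign:
  assumes "d < 1" and eq: "abs.energy (log_kernel s p) = energy (log_kernel s p)"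
  shows "(AE x in lborel. 0 \<le> v x) \<or> (AE x in lborel. v x \<le> 0)"
proof (rule AE_sign_of_AE_product_nonneg)
  have "AE z in lborel. energy_density p (log_kernel s p) (\<lambda>x. \<bar>v x\<bar>) (\<lambda>x. \<bar>v x\<bar>) z =
      energy_density p (log_kernel s p) v v z"
    using abs_log_density_le[OF assms(1)] eq
    by (intro integral_ineq_eq_0_then_AE abs.log_integrable log_integrable) auto
  then show "AE z in lborel. 0 \<le> v (fst z) * v (snd z)"
  proof eventually_elim
    case (elim z)
    obtain x y where z: "z = (x, y)" by fastforce
    show ?case
    proof (cases "x \<in> \<Omega> \<and> y \<in> \<Omega> \<and> x \<noteq> y")
      case True
      then have "dist x y \<le> d"
        using bounded_domain by (intro diameter_bounded_bound) auto
      then have "0 < log_kernel s p (x - y)"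
        using assms True by (intro log_kernel_pos_near) (auto simp: dist_norm)
      with elim have "\<bar>\<bar>v x\<bar> - \<bar>v y\<bar>\<bar> powr p = \<bar>v x - v y\<bar> powr p"
        by (simp add: energy_density_diag z)
      then have "\<bar>\<bar>v x\<bar> - \<bar>v y\<bar>\<bar> = \<bar>v x - v y\<bar>"
        using p powr_less_mono2[of p "\<bar>\<bar>v x\<bar> - \<bar>v y\<bar>\<bar>" "\<bar>v x - v y\<bar>"]
          abs_triangle_ineq3[of "v x" "v y"] by fastforce
      then show ?thesis
        by (auto simp: z zero_le_mult_iff abs_if split: if_splits)
    qed (use outside[of x] outside[of y] in \<open>auto simp: z\<close>)
  qed
qed

lemma frac_term_nonneg: "0 \<le> B_const DIM('a) s p \<Longrightarrow>
    0 \<le> B_const DIM('a) s p * C_const DIM('a) s p / 2 * energy (frac_kernel s p)"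
  using C_pos[where 'a='a] energy_nonneg[where k = "frac_kernel s p", OF frac_kernel_nonneg] by simp

lemma slog_energy_nonneg:
  assumes "d \<le> exp (- (1 / (s * p)))" "0 \<le> B_const DIM('a) s p"
  shows "0 \<le> slog_energy"
  using p log_energy_nonneg[OF assms(1)] frac_term_nonneg[OF assms(2)] by (simp add: slog_energy_alt)

lemma energy_eq_0: "AE x in lborel. v x = 0 \<Longrightarrow> energy k = 0"
proof (rule integral_eq_zero_AE)
  assume "AE x in lborel. v x = 0"
  from AE_lborel_pair_both[OF this] show "AE z in lborel. energy_density p k v v z = 0"
    by eventually_elim (simp add: energy_density_diag)
qed

lemma slog_energy_eq_0_iff:
  assumes d: "d \<le> exp (- (1 / (s * p)))" and B: "0 \<le> B_const DIM('a) s p"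
  shows "slog_energy = 0 \<longleftrightarrow> (AE x in lborel. v x = 0)"
proof
  assume "slog_energy = 0"
  then have "p / 2 * energy (log_kernel s p) \<le> 0"
    using frac_term_nonneg[OF B] by (simp only: slog_energy_alt)
  then have "energy (log_kernel s p) \<le> 0"
    using p by (simp add: mult_le_0_iff)
  then show "AE x in lborel. v x = 0"
    by (rule log_energy_definite[OF d])
next
  assume "AE x in lborel. v x = 0"
  from energy_eq_0[OF this] show "slog_energy = 0"
    by (simp add: slog_energy_def)
qed

lemma abs_energies_le:
  assumes d: "d < 1"
  shows "abs.energy (log_kernel s p) \<le> energy (log_kernel s p)"
    and "abs.energy (frac_kernel s p) \<le> energy (frac_kernel s p)"
proof -
  have half: "0 < (1/2 :: real)" "(1/2 :: real) < 1" by auto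
  show "abs.energy (log_kernel s p) \<le> energy (log_kernel s p)"
    by (rule integral_mono[OF abs.log_integrable log_integrable abs_log_density_le[OF d]])
  show "abs.energy (frac_kernel s p) \<le> energy (frac_kernel s p)"
    by (rule integral_mono[OF abs.frac_integrable_and_le(1)[OF half] frac_integrable_and_le(1)[OF half]
          abs_density_le[where k = "frac_kernel s p", OF frac_kernel_nonneg]])
qed

lemma abs_slog_energy:
  assumes d: "d \<le> exp (- (1 / (s * p)))" and B: "0 \<le> B_const DIM('a) s p"
  shows "abs.slog_energy \<le> slog_energy"
    and "abs.slog_energy = slog_energy \<Longrightarrow> (AE x in lborel. 0 \<le> v x) \<or> (AE x in lborel. v x \<le> 0)"
proof -
  note le = abs_energies_le[OF diameter_less_1[OF d]]
  have l: "p / 2 * abs.energy (log_kernel s p) \<le> p / 2 * energy (log_kernel s p)"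
    using p le(1) by (intro mult_left_mono) auto
  have f: "B_const DIM('a) s p * C_const DIM('a) s p / 2 * abs.energy (frac_kernel s p) \<le>
      B_const DIM('a) s p * C_const DIM('a) s p / 2 * energy (frac_kernel s p)"
    using B C_pos[where 'a='a] le(2) by (intro mult_left_mono) auto
  show "abs.slog_energy \<le> slog_energy"
    unfolding slog_energy_alt abs.slog_energy_alt using l f by (rule add_mono)
  assume "abs.slog_energy = slog_energy"
  then have "p / 2 * abs.energy (log_kernel s p) = p / 2 * energy (log_kernel s p)"
    unfolding slog_energy_alt abs.slog_energy_alt using l f by linarith
  then have "abs.energy (log_kernel s p) = energy (log_kernel s p)"
    using p by simp
  then show "(AE x in lborel. 0 \<le> v x) \<or> (AE x in lborel. v x \<le> 0)"
    by (rule abs_log_energy_eq_imp_sign[OF diameter_less_1[OF d]])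
qed

end

section \<open>Passage to classes modulo equality almost everywhere\<close>

lemma lebesgue_integral_borel_representative:
  fixes g h :: "'a::euclidean_space \<Rightarrow> real"
  assumes h: "h \<in> borel_measurable borel" and eq: "AE z in lborel. g z = h z"
  shows "integrable lebesgue g \<longleftrightarrow> integrable lborel h"
    and "integral\<^sup>L lebesgue g = integral\<^sup>L lborel h"
proof -
  have hl: "h \<in> borel_measurable lebesgue" "h \<in> borel_measurable lborel"
    using h by (auto intro: measurable_completion)
  have eq': "AE z in lebesgue. g z = h z"
    using eq by (rule AE_completion)
  have gl: "g \<in> borel_measurable lebesgue"
    by (rule borel_measurable_AE[OF hl(1)]) (use eq' in \<open>auto elim!: eventually_mono\<close>)
  have "integrable lebesgue g \<longleftrightarrow> integrable lebesgue h"
    by (rule integrable_cong_AE[OF gl hl(1) eq'])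
  then show "integrable lebesgue g \<longleftrightarrow> integrable lborel h"
    using integrable_completion[OF hl(2)] by simp
  have "integral\<^sup>L lebesgue g = integral\<^sup>L lebesgue h"
    by (rule integral_cong_AE[OF gl hl(1) eq'])
  then show "integral\<^sup>L lebesgue g = integral\<^sup>L lborel h"
    using integral_completion[OF hl(2)] by simp
qed

lemma energy_density_representative:
  fixes u v k :: "'a::euclidean_space \<Rightarrow> real"
  assumes "v \<in> borel_measurable borel" "k \<in> borel_measurable borel" and eq: "AE x in lborel. u x = v x"
  shows "integrable lebesgue (energy_density p k u u) \<longleftrightarrow> integrable lborel (energy_density p k v v)"
    and "integral\<^sup>L lebesgue (energy_density p k u u) = integral\<^sup>L lborel (energy_density p k v v)"
proof -
  have "AE z in lborel. energy_density p k u u z = energy_density p k v v z"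
    using AE_lborel_pair_both[OF eq] by eventually_elim (simp add: energy_density_diag)
  note R = lebesgue_integral_borel_representative[OF energy_density_measurable[OF assms(1,2)] this]
  show "integrable lebesgue (energy_density p k u u) \<longleftrightarrow> integrable lborel (energy_density p k v v)"
    "integral\<^sup>L lebesgue (energy_density p k u u) = integral\<^sup>L lborel (energy_density p k v v)"
    by (fact R)+
qed

lemma seminorm_density_eq:
  "(\<lambda>(x, y). \<bar>u x - u y\<bar> powr p * k (x - y)) = energy_density p k u u"
  by (auto simp: energy_density_diag)

context slog_function
begin

lemma
  assumes eq: "AE x in lborel. u x = v x"
  shows Lp_integrable_representative: "integrable lebesgue (\<lambda>x. \<bar>u x\<bar> powr p)"
    and Lp_norm_representative: "Lp_norm p \<Omega> u powr p = mass"
proof -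
  show "integrable lebesgue (\<lambda>x. \<bar>u x\<bar> powr p)"
    by (subst lebesgue_integral_borel_representative(1)[where h = "\<lambda>x. \<bar>v x\<bar> powr p"])
      (use eq Lp in \<open>auto elim!: eventually_mono\<close>)
  have "(LINT x:\<Omega>|lebesgue. \<bar>u x\<bar> powr p) = mass"
    unfolding set_lebesgue_integral_def
    by (rule lebesgue_integral_borel_representative(2))
      (use eq outside in \<open>auto elim!: eventually_mono split: split_indicator\<close>)
  moreover have "0 \<le> mass"
    by (simp add: integral_nonneg_AE)
  ultimately show "Lp_norm p \<Omega> u powr p = mass"
    using p by (simp add: Lp_norm_def powr_powr)
qed

lemma energies_representative:
  assumes eq: "AE x in lborel. u x = v x"
  shows "J_pos s p u u = energy (log_kernel_pos s p)" "J_neg s p u u = energy (log_kernel_neg s p)"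
    "J_frac s p u u = energy (frac_kernel s p)" "J_slog s p u u = slog_energy"
    "W_slog_0_norm s p u powr p = energy (log_kernel_pos s p)"
proof -
  note R = energy_density_representative(2)[OF borel _ eq]
  show *: "J_pos s p u u = energy (log_kernel_pos s p)" "J_neg s p u u = energy (log_kernel_neg s p)"
    "J_frac s p u u = energy (frac_kernel s p)"
    by (simp_all add: J_pos_def J_neg_def J_frac_def R)
  then show "J_slog s p u u = slog_energy"
    by (simp add: J_slog_def slog_energy_def)
  show "W_slog_0_norm s p u powr p = energy (log_kernel_pos s p)"
    using p energy_nonneg[where k = "log_kernel_pos s p", OF log_kernel_pos_nonneg]
    by (simp add: W_slog_0_norm_def slog_seminorm_def seminorm_density_eq R powr_powr)
qed

lemma W_slog_0_representative:
  assumes eq: "AE x in lborel. u x = v x"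
  shows "u \<in> W_slog_0 s p \<Omega>"
proof -
  have "u \<in> borel_measurable lebesgue"
    by (rule borel_measurable_AE[where f = v])
      (use eq in \<open>auto intro!: measurable_completion AE_completion elim!: eventually_mono\<close>)
  moreover have "AE x in lebesgue. x \<notin> \<Omega> \<longrightarrow> u x = 0"
    by (rule AE_completion) (use eq outside in \<open>auto elim!: eventually_mono\<close>)
  ultimately show ?thesis
    using Lp_integrable_representative[OF eq] energy_density_representative(1)[OF borel _ eq] pos_integrable
    by (simp add: W_slog_0_def W_slog_def seminorm_density_eq)
qed

end

text \<open>
  Take a Borel function equal to \<open>u\<close> almost everywhere and multiply it by the indicator of \<open>\<Omega>\<close>;
  this changes it on a null set only, since \<open>u\<close> vanishes almost everywhere outside \<open>\<Omega>\<close>.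
\<close>

lemma (in slog_exponents) W_slog_0_obtain_representative:
  fixes \<Omega> :: "'a::euclidean_space set"
  assumes "open \<Omega>" "bounded \<Omega>" and u: "u \<in> W_slog_0 s p \<Omega>"
  obtains v where "slog_function s p \<Omega> v" "AE x in lborel. u x = v x"
proof -
  have [measurable]: "\<Omega> \<in> sets borel"
    using assms by simp
  have um: "u \<in> borel_measurable lebesgue" and up: "integrable lebesgue (\<lambda>x. \<bar>u x\<bar> powr p)"
    and ue: "integrable lebesgue (energy_density p (log_kernel_pos s p) u u)"
    and u0: "AE x in lborel. x \<notin> \<Omega> \<longrightarrow> u x = 0"
    using u by (auto simp: W_slog_0_def W_slog_def seminorm_density_eq AE_completion_iff)
  obtain v0 where v0[measurable]: "v0 \<in> borel_measurable borel" and eq0: "AE x in lborel. u x = v0 x"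
    using completion_ex_borel_measurable_real[OF um] by auto
  define v where "v = (\<lambda>x. indicator \<Omega> x * v0 x)"
  have v[measurable]: "v \<in> borel_measurable borel"
    by (simp add: v_def)
  have eq: "AE x in lborel. u x = v x"
    using eq0 u0 by eventually_elim (auto simp: v_def indicator_def)
  have "slog_function s p \<Omega> v"
  proof
    show "integrable lborel (\<lambda>x. \<bar>v x\<bar> powr p)"
      by (subst lebesgue_integral_borel_representative(1)[where g = "\<lambda>x. \<bar>u x\<bar> powr p", symmetric])
        (use eq up in \<open>auto elim!: eventually_mono\<close>)
    show "integrable lborel (energy_density p (log_kernel_pos s p) v v)"
      using energy_density_representative(1)[OF v _ eq] ue by simp
  qed (use assms v in \<open>auto simp: v_def\<close>)
  then show thesis
    using that eq by blast
qed

section \<open>The energy estimates\<close>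

theorem proposition2p4:
  fixes \<Omega> :: "'a::euclidean_space set" and u :: "'a \<Rightarrow> real" and s p :: real
  assumes "1 < p" and "0 < s" and "s < 1"
    and "bounded \<Omega>" and "open \<Omega>" and "lipschitz_boundary \<Omega>"
    and "u \<in> W_slog_0 s p \<Omega>"
  shows
    "(integrable lebesgue (energy_density p (log_kernel_neg s p) u u) \<and>
      0 \<le> J_neg s p u u \<and>
      J_neg s p u u \<le>
        2 powr p * sphere_area DIM('a) / (s * p)\<^sup>2 * C_const DIM('a) s p * Lp_norm p \<Omega> u powr p)
   \<and> ((diameter \<Omega> < 1 \<longrightarrow>
        J_pos s p u u - J_neg s p u u \<ge>
          - (2 * sphere_area DIM('a) / (s * p) * C_const DIM('a) s p *
             diameter \<Omega> powr (- (s * p)) * (ln (diameter \<Omega>) + 1 / (s * p)) * Lp_norm p \<Omega> u powr p)) \<and>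
      (diameter \<Omega> \<le> exp (- (1 / (s * p))) \<longrightarrow> J_pos s p u u - J_neg s p u u \<ge> 0))
   \<and> (integrable lebesgue (energy_density p (frac_kernel s p) u u) \<and>
      (\<forall>r. 0 < r \<and> r < 1 \<longrightarrow>
        J_frac s p u u \<le>
          - (1 / (C_const DIM('a) s p * ln r)) * W_slog_0_norm s p u powr p +
          2 powr p * sphere_area DIM('a) / (s * p) * r powr (- (s * p)) * Lp_norm p \<Omega> u powr p))
   \<and> (diameter \<Omega> \<le> exp (- (1 / (s * p))) \<and> B_const DIM('a) s p \<ge> 0 \<longrightarrow>
      (\<forall>w \<in> W_slog_0 s p \<Omega>. 0 \<le> J_slog s p w w \<and>
         (J_slog s p w w = 0 \<longleftrightarrow> (AE x in lebesgue. w x = 0))) \<and>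
      (\<lambda>x. \<bar>u x\<bar>) \<in> W_slog_0 s p \<Omega> \<and>
      J_slog s p (\<lambda>x. \<bar>u x\<bar>) (\<lambda>x. \<bar>u x\<bar>) \<le> J_slog s p u u \<and>
      (J_slog s p (\<lambda>x. \<bar>u x\<bar>) (\<lambda>x. \<bar>u x\<bar>) = J_slog s p u u \<longleftrightarrow>
         (AE x in lebesgue. 0 \<le> u x) \<or> (AE x in lebesgue. u x \<le> 0)))"
proof -
  interpret slog_exponents s p
    by unfold_locales (use assms in auto)
  obtain v where v: "slog_function s p \<Omega> v" and eq: "AE x in lborel. u x = v x"
    using W_slog_0_obtain_representative[OF assms(5,4,7)] .
  interpret v: slog_function s p \<Omega> v
    by (rule v)
  interpret a: slog_function s p \<Omega> "\<lambda>x. \<bar>v x\<bar>"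
    by (rule v.abs_slog_function)
  have eq_abs: "AE x in lborel. \<bar>u x\<bar> = \<bar>v x\<bar>"
    using eq by eventually_elim simp
  note J = v.energies_representative[OF eq] v.Lp_norm_representative[OF eq]
  have half: "0 < (1/2 :: real)" "(1/2 :: real) < 1"
    by auto
  have definite: "0 \<le> J_slog s p w w \<and> (J_slog s p w w = 0 \<longleftrightarrow> (AE x in lebesgue. w x = 0))"
    if d: "diameter \<Omega> \<le> exp (- (1 / (s * p)))" and B: "B_const DIM('a) s p \<ge> 0"
      and w: "w \<in> W_slog_0 s p \<Omega>" for w
  proof -
    obtain f where f: "slog_function s p \<Omega> f" and wf: "AE x in lborel. w x = f x"
      using W_slog_0_obtain_representative[OF assms(5,4) w] .
    interpret f: slog_function s p \<Omega> f
      by (rule f)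
    have "(AE x in lebesgue. w x = 0) \<longleftrightarrow> (AE x in lborel. f x = 0)"
      unfolding AE_completion_iff by (rule eventually_subst) (use wf in \<open>auto elim!: eventually_mono\<close>)
    then show ?thesis
      using f.slog_energy_nonneg[OF d B] f.slog_energy_eq_0_iff[OF d B] f.energies_representative(4)[OF wf]
      by simp
  qed
  have sign: "J_slog s p (\<lambda>x. \<bar>u x\<bar>) (\<lambda>x. \<bar>u x\<bar>) = J_slog s p u u \<longleftrightarrow>
      (AE x in lebesgue. 0 \<le> u x) \<or> (AE x in lebesgue. u x \<le> 0)"
    if d: "diameter \<Omega> \<le> exp (- (1 / (s * p)))" and B: "B_const DIM('a) s p \<ge> 0"
  proof
    assume "J_slog s p (\<lambda>x. \<bar>u x\<bar>) (\<lambda>x. \<bar>u x\<bar>) = J_slog s p u u"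
    then have "(AE x in lborel. 0 \<le> v x) \<or> (AE x in lborel. v x \<le> 0)"
      using v.abs_slog_energy(2)[OF d B] J a.energies_representative[OF eq_abs] by simp
    then show "(AE x in lebesgue. 0 \<le> u x) \<or> (AE x in lebesgue. u x \<le> 0)"
      unfolding AE_completion_iff
    proof
      assume "AE x in lborel. 0 \<le> v x"
      with eq have "AE x in lborel. 0 \<le> u x" by eventually_elim simp
      then show "(AE x in lborel. 0 \<le> u x) \<or> (AE x in lborel. u x \<le> 0)" ..
    next
      assume "AE x in lborel. v x \<le> 0"
      with eq have "AE x in lborel. u x \<le> 0" by eventually_elim simp
      then show "(AE x in lborel. 0 \<le> u x) \<or> (AE x in lborel. u x \<le> 0)" ..
    qed
  next
    \<comment> \<open>Both signs at once: if \<open>\<bar>u\<bar> = c * u\<close> with \<open>c = 1\<close> or \<open>c = - 1\<close>, all increments keep their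
      absolute value.\<close>
    have key: "J_slog s p (\<lambda>x. \<bar>u x\<bar>) (\<lambda>x. \<bar>u x\<bar>) = J_slog s p u u"
      if "c = 1 \<or> c = -1" "AE x in lborel. \<bar>u x\<bar> = c * u x" for c :: real
    proof -
      have "AE x in lborel. \<bar>v x\<bar> = c * v x"
        using eq that(2) by eventually_elim simp
      then have "AE z in lborel. energy_density p k (\<lambda>x. \<bar>v x\<bar>) (\<lambda>x. \<bar>v x\<bar>) z = energy_density p k v v z" for k
        using that(1)
        by (auto dest!: AE_lborel_pair_both elim!: eventually_mono simp: energy_density_diag abs_minus_commute)
      then have "a.energy k = v.energy k" if "k \<in> borel_measurable borel" for k
        using that by (intro integral_cong_AE) auto
      then show ?thesis
        using J a.energies_representative[OF eq_abs] by (simp add: v.slog_energy_def a.slog_energy_def)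
    qed
    assume "(AE x in lebesgue. 0 \<le> u x) \<or> (AE x in lebesgue. u x \<le> 0)"
    then show "J_slog s p (\<lambda>x. \<bar>u x\<bar>) (\<lambda>x. \<bar>u x\<bar>) = J_slog s p u u"
      unfolding AE_completion_iff
    proof
      assume "AE x in lborel. 0 \<le> u x"
      then have "AE x in lborel. \<bar>u x\<bar> = 1 * u x" by eventually_elim simp
      then show ?thesis by (rule key[rotated]) simp
    next
      assume "AE x in lborel. u x \<le> 0"
      then have "AE x in lborel. \<bar>u x\<bar> = - 1 * u x" by eventually_elim simp
      then show ?thesis by (rule key[rotated]) simp
    qed
  qed
  have ineq: "J_slog s p (\<lambda>x. \<bar>u x\<bar>) (\<lambda>x. \<bar>u x\<bar>) \<le> J_slog s p u u"
    if "diameter \<Omega> \<le> exp (- (1 / (s * p)))" "B_const DIM('a) s p \<ge> 0"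
    using v.abs_slog_energy(1)[OF that] J a.energies_representative[OF eq_abs] by simp
  show ?thesis
  proof (intro conjI impI ballI allI)
    show "integrable lebesgue (energy_density p (log_kernel_neg s p) u u)"
      using energy_density_representative(1)[OF v.borel _ eq] v.neg_integrable by simp
    show "integrable lebesgue (energy_density p (frac_kernel s p) u u)"
      using energy_density_representative(1)[OF v.borel _ eq] v.frac_integrable_and_le(1)[OF half] by simp
    show "0 \<le> J_neg s p u u"
      using v.energy_nonneg[where k = "log_kernel_neg s p", OF log_kernel_neg_nonneg] J by simp
    show "J_neg s p u u \<le>
        2 powr p * sphere_area DIM('a) / (s * p)\<^sup>2 * C_const DIM('a) s p * Lp_norm p \<Omega> u powr p"
      using v.neg_le J by (simp add: mult_ac)
    show "- (2 * sphere_area DIM('a) / (s * p) * C_const DIM('a) s p *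
             diameter \<Omega> powr (- (s * p)) * (ln (diameter \<Omega>) + 1 / (s * p)) * Lp_norm p \<Omega> u powr p)
        \<le> J_pos s p u u - J_neg s p u u" if "diameter \<Omega> < 1"
      using v.log_energy_ge[OF that] unfolding J v.log_energy v.far_energy_def .
    show "0 \<le> J_pos s p u u - J_neg s p u u" if "diameter \<Omega> \<le> exp (- (1 / (s * p)))"
      using v.log_energy_nonneg[OF that] unfolding J v.log_energy .
    show "J_frac s p u u \<le>
          - (1 / (C_const DIM('a) s p * ln r)) * W_slog_0_norm s p u powr p +
          2 powr p * sphere_area DIM('a) / (s * p) * r powr (- (s * p)) * Lp_norm p \<Omega> u powr p"
      if "0 < r \<and> r < 1" for r
      using v.frac_integrable_and_le(2)[of r] that J by (simp add: mult_ac)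
    show "(\<lambda>x. \<bar>u x\<bar>) \<in> W_slog_0 s p \<Omega>"
      by (rule a.W_slog_0_representative[OF eq_abs])
  qed (use definite sign ineq in auto)
qed

end
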